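(* For each $\delta>0$ there is $\epsilon>0$ such that the following holds for every $n\in\mathbb{N}$. If $f\colon\{0,1\}^n\to\{0,1\}$ satisfies \[ \Pr_{\mathbf{x},\mathbf{y}}\big[f(\mathbf{x}\wedge\mathbf{y}) = f(\mathbf{x})\wedge f(\mathbf{y})\big]\ \ge\ 1-\epsilon, \] where $\mathbf{x},\mathbf{y}\in\{0,1\}^n$ are independent and uniformly random, then $f$ is $\delta$-close to a constant function or to an AND function, i.e. there is a function $h$ which is either constant or of the form $h(x)=\bigwedge_{i\in S}x_i$ for some $S\subseteq[n]$, with $\Pr_{\mathbf{x}}[f(\mathbf{x})\neq h(\mathbf{x})]\le\delta$ for uniform $\mathbf{x}$.
   Context: For $x,y\in\{0,1\}^n$, $x\wedge y$ denotes the coordinatewise AND $(x_1\wedge y_1,\ldots,x_n\wedge y_n)$. *)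

theory Defs
  imports "HOL-Probability.Probability"
begin

text \<open>
  Points of \<open>{0,1}\<^sup>n\<close> are extensional functions on the index set \<open>{..<n}\<close>, with \<open>True\<close> in the role
  of 1. A Boolean function on the cube is a total function on \<open>nat \<Rightarrow> bool\<close>; its values outside
  \<open>cube n\<close> never matter below.
\<close>

definition cube :: "nat \<Rightarrow> (nat \<Rightarrow> bool) set" where
  "cube n = {..<n} \<rightarrow>\<^sub>E UNIV"

text \<open>The restriction makes the result extensional again, so that it lies in \<open>cube n\<close>.\<close>

definition cube_and :: "nat \<Rightarrow> (nat \<Rightarrow> bool) \<Rightarrow> (nat \<Rightarrow> bool) \<Rightarrow> (nat \<Rightarrow> bool)" where
  "cube_and n x y = (\<lambda>i\<in>{..<n}. x i \<and> y i)"

definition unif_cube :: "nat \<Rightarrow> (nat \<Rightarrow> bool) pmf" where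
  "unif_cube n = pmf_of_set (cube n)"

definition const_fun_on_cube :: "nat \<Rightarrow> ((nat \<Rightarrow> bool) \<Rightarrow> bool) \<Rightarrow> bool" where
  "const_fun_on_cube n h \<longleftrightarrow> (\<exists>c. \<forall>x\<in>cube n. h x = c)"

definition and_fun_on_cube :: "nat \<Rightarrow> ((nat \<Rightarrow> bool) \<Rightarrow> bool) \<Rightarrow> bool" where
  "and_fun_on_cube n h \<longleftrightarrow> (\<exists>S\<subseteq>{..<n}. \<forall>x\<in>cube n. h x = (\<forall>i\<in>S. x i))"

lemma finite_cube: "finite (cube n)"
  by (simp add: cube_def finite_PiE)

lemma cube_nonempty: "cube n \<noteq> {}"
  by (simp add: cube_def PiE_eq_empty_iff)

lemma card_cube: "card (cube n) = 2 ^ n"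
  by (simp add: cube_def card_PiE)

lemma set_pmf_unif_cube: "set_pmf (unif_cube n) = cube n"
  by (simp add: unif_cube_def finite_cube cube_nonempty)

lemma cube_and_in_cube: "cube_and n x y \<in> cube n"
  by (simp add: cube_def cube_and_def)

end

theory Submission
  imports Defs
begin

text \<open>
  For a typical \<open>x\<close> with \<open>f(x) = 1\<close>, the function \<open>f(y)\<close> is close to \<open>f(x \<and> y)\<close>, which depends only
  on the coordinates in the support of \<open>x\<close>. Averaging over such \<open>x\<close>, almost all Fourier weight of \<open>f\<close>
  sits on sets \<open>S\<close> with \<open>S \<subseteq> supp x\<close> for almost all \<open>x\<close> with \<open>f(x) = 1\<close>, hence on subsets of the set
  \<open>I\<close> of coordinates that are almost always 1 when \<open>f = 1\<close>. If \<open>f\<close> is not close to 0, then the size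
  of \<open>I\<close> is bounded independently of \<open>n\<close>, since \<open>f\<close> cannot have more mass than the subcube on which
  the coordinates in \<open>I\<close> are 1. So \<open>f\<close> is close to a function of the coordinates in \<open>I\<close> and nearly
  vanishes off that subcube; on the subcube it is nearly constant, so \<open>f\<close> is close to the AND over \<open>I\<close>.
\<close>

section \<open>Averages over the cube and Walsh-Fourier analysis\<close>

definition cube_mean :: "nat \<Rightarrow> ((nat \<Rightarrow> bool) \<Rightarrow> real) \<Rightarrow> real" where
  "cube_mean n \<phi> = (\<Sum>x\<in>cube n. \<phi> x) / 2 ^ n"

text \<open>These are the characters of the group \<open>{0,1}^n\<close> under coordinatewise
  addition modulo 2, with \<open>True\<close> as the nonzero element.\<close>

definition walsh :: "nat set \<Rightarrow> (nat \<Rightarrow> bool) \<Rightarrow> real" where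
  "walsh S x = (\<Prod>i\<in>S. if x i then - 1 else 1)"

definition walsh_coeff :: "nat \<Rightarrow> ((nat \<Rightarrow> bool) \<Rightarrow> real) \<Rightarrow> nat set \<Rightarrow> real" where
  "walsh_coeff n \<phi> S = cube_mean n (\<lambda>x. \<phi> x * walsh S x)"

lemma cube_mean_mono:
  "(\<And>x. x \<in> cube n \<Longrightarrow> \<phi> x \<le> \<psi> x) \<Longrightarrow> cube_mean n \<phi> \<le> cube_mean n \<psi>"
  unfolding cube_mean_def by (intro divide_right_mono sum_mono) auto

lemma cube_mean_cong:
  "(\<And>x. x \<in> cube n \<Longrightarrow> \<phi> x = \<psi> x) \<Longrightarrow> cube_mean n \<phi> = cube_mean n \<psi>"
  unfolding cube_mean_def by (simp cong: sum.cong)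

lemma cube_mean_add: "cube_mean n (\<lambda>x. \<phi> x + \<psi> x) = cube_mean n \<phi> + cube_mean n \<psi>"
  by (simp add: cube_mean_def sum.distrib add_divide_distrib)

lemma cube_mean_diff: "cube_mean n (\<lambda>x. \<phi> x - \<psi> x) = cube_mean n \<phi> - cube_mean n \<psi>"
  by (simp add: cube_mean_def sum_subtractf diff_divide_distrib)

lemma cube_mean_mult_left: "cube_mean n (\<lambda>x. c * \<phi> x) = c * cube_mean n \<phi>"
  by (simp add: cube_mean_def sum_distrib_left)

lemma cube_mean_mult_right: "cube_mean n (\<lambda>x. \<phi> x * c) = cube_mean n \<phi> * c"
  by (simp add: cube_mean_def sum_distrib_right)

lemma cube_mean_sum: "cube_mean n (\<lambda>x. \<Sum>a\<in>A. \<phi> a x) = (\<Sum>a\<in>A. cube_mean n (\<phi> a))"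
  unfolding cube_mean_def by (subst sum.swap) (simp add: sum_divide_distrib)

lemma cube_mean_const: "cube_mean n (\<lambda>_. c) = c"
  by (simp add: cube_mean_def card_cube)

lemma cube_mean_nonneg: "(\<And>x. x \<in> cube n \<Longrightarrow> 0 \<le> \<phi> x) \<Longrightarrow> 0 \<le> cube_mean n \<phi>"
  using cube_mean_mono[of n "\<lambda>_. 0" \<phi>] by (simp add: cube_mean_const)

text \<open>Flipping coordinate \<open>i\<close> is an involution of the cube that pairs opposite
  values, so the sum equals its own negative.\<close>

lemma cube_mean_flip_eq_0:
  assumes "i < n" and "\<And>x. x \<in> cube n \<Longrightarrow> \<phi> (x(i := \<not> x i)) = - \<phi> x"
  shows "cube_mean n \<phi> = 0"
proof -
  have flip: "x(i := \<not> x i) \<in> cube n" if "x \<in> cube n" for x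
    using that \<open>i < n\<close> by (auto simp: cube_def PiE_iff extensional_def)
  have "(\<Sum>x\<in>cube n. \<phi> x) = (\<Sum>x\<in>cube n. - \<phi> x)"
    by (rule sum.reindex_bij_witness[where i="\<lambda>x. x(i := \<not> x i)" and j="\<lambda>x. x(i := \<not> x i)"])
       (use flip assms in auto)
  then show ?thesis
    by (simp add: cube_mean_def sum_negf)
qed

lemma walsh_flip:
  assumes "finite S"
  shows "walsh S (x(i := \<not> x i)) = (if i \<in> S then - walsh S x else walsh S x)"
proof (cases "i \<in> S")
  case True
  then have "walsh S y = (if y i then - 1 else 1) * walsh (S - {i}) y" for y
    using assms by (simp add: walsh_def prod.remove)
  moreover have "walsh (S - {i}) (x(i := \<not> x i)) = walsh (S - {i}) x"
    unfolding walsh_def by (intro prod.cong) auto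
  ultimately show ?thesis
    using True by simp
next
  case False
  then show ?thesis
    unfolding walsh_def by (auto intro!: prod.cong)
qed

lemma walsh_square: "walsh S x * walsh S x = 1"
  unfolding walsh_def by (simp flip: prod.distrib) (rule prod.neutral, simp)

text \<open>For distinct sets, flipping a coordinate that lies in exactly one of them negates the
  product.\<close>

lemma walsh_orthonormal:
  assumes "S \<subseteq> {..<n}" "T \<subseteq> {..<n}"
  shows "cube_mean n (\<lambda>x. walsh S x * walsh T x) = of_bool (S = T)"
proof (cases "S = T")
  case True
  then show ?thesis
    by (simp add: walsh_square cube_mean_const)
next
  case False
  then obtain i where i: "i \<in> S \<longleftrightarrow> i \<notin> T" by blast
  have "finite S" "finite T"
    using assms finite_subset by blast+
  moreover have "i < n" using i assms by auto
  ultimately show ?thesis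
    using False i by (auto intro!: cube_mean_flip_eq_0[of i] simp: walsh_flip)
qed

text \<open>Dual orthogonality: the sum over all \<open>S\<close> factors into one factor per
  coordinate, equal to 2 where \<open>x\<close> and \<open>y\<close> agree and to 0 where they
  differ.\<close>

lemma sum_Pow_walsh:
  assumes "x \<in> cube n" "y \<in> cube n"
  shows "(\<Sum>S\<in>Pow {..<n}. walsh S x * walsh S y) = (if x = y then 2 ^ n else 0)"
proof -
  define a :: "nat \<Rightarrow> real" where "a i = (if x i = y i then 1 else - 1)" for i
  have "walsh S x * walsh S y = prod a S" for S
    unfolding walsh_def a_def by (simp flip: prod.distrib) (rule prod.cong, auto)
  then have *: "(\<Sum>S\<in>Pow {..<n}. walsh S x * walsh S y) = (\<Prod>i<n. a i + 1)"
    by (simp add: prod_add)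
  show ?thesis
  proof (cases "x = y")
    case True
    then show ?thesis by (subst *) (simp add: a_def)
  next
    case False
    \<comment> \<open>Points of the cube are extensional, so distinct ones differ at an index below
      \<open>n\<close>.\<close>
    have "\<exists>i\<in>{..<n}. x i \<noteq> y i"
    proof (rule ccontr)
      assume "\<not> (\<exists>i\<in>{..<n}. x i \<noteq> y i)"
      then have "x = y"
        using assms unfolding cube_def by (intro PiE_ext[of x _ _ y]) blast+
      with False show False ..
    qed
    then obtain i where "i < n" "x i \<noteq> y i" by auto
    then have "i \<in> {..<n}" "a i + 1 = 0" by (simp_all add: a_def)
    then have "(\<Prod>i<n. a i + 1) = 0"
      by (meson finite_lessThan prod_zero)
    with False show ?thesis by (simp only: * if_False)
  qed
qed

text \<open>Exchanging the sum over \<open>S\<close> with the average leaves the kernel of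
  \<open>sum_Pow_walsh\<close>, a multiple of the point mass at \<open>x\<close>.\<close>

lemma walsh_expansion:
  assumes "x \<in> cube n"
  shows "(\<Sum>S\<in>Pow {..<n}. walsh_coeff n \<phi> S * walsh S x) = \<phi> x"
proof -
  have "(\<Sum>S\<in>Pow {..<n}. walsh_coeff n \<phi> S * walsh S x)
      = cube_mean n (\<lambda>y. \<phi> y * (\<Sum>S\<in>Pow {..<n}. walsh S y * walsh S x))"
    by (simp add: walsh_coeff_def cube_mean_sum sum_distrib_left mult.assoc[symmetric]
        cube_mean_mult_right)
  also have "\<dots> = cube_mean n (\<lambda>y. if y = x then \<phi> x * 2 ^ n else 0)"
    using assms by (intro cube_mean_cong) (simp add: sum_Pow_walsh)
  also have "\<dots> = \<phi> x"
    using assms by (simp add: cube_mean_def finite_cube)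
  finally show ?thesis .
qed

text \<open>Expand one of the two factors of the square in Walsh functions; averaging against the
  other factor reproduces the coefficients.\<close>

lemma parseval: "(\<Sum>S\<in>Pow {..<n}. (walsh_coeff n \<phi> S)\<^sup>2) = cube_mean n (\<lambda>x. (\<phi> x)\<^sup>2)"
proof -
  have "cube_mean n (\<lambda>x. (\<phi> x)\<^sup>2)
      = cube_mean n (\<lambda>x. \<Sum>S\<in>Pow {..<n}. walsh_coeff n \<phi> S * (\<phi> x * walsh S x))"
  proof (rule cube_mean_cong)
    fix x assume "x \<in> cube n"
    have "(\<phi> x)\<^sup>2 = \<phi> x * (\<Sum>S\<in>Pow {..<n}. walsh_coeff n \<phi> S * walsh S x)"
      using walsh_expansion[OF \<open>x \<in> cube n\<close>] by (simp add: power2_eq_square)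
    then show "(\<phi> x)\<^sup>2 = (\<Sum>S\<in>Pow {..<n}. walsh_coeff n \<phi> S * (\<phi> x * walsh S x))"
      by (simp add: sum_distrib_left mult_ac)
  qed
  then show ?thesis
    by (simp add: cube_mean_sum cube_mean_mult_left power2_eq_square flip: walsh_coeff_def)
qed

lemma walsh_coeff_diff:
  "walsh_coeff n (\<lambda>x. \<phi> x - \<psi> x) S = walsh_coeff n \<phi> S - walsh_coeff n \<psi> S"
  by (simp add: walsh_coeff_def left_diff_distrib cube_mean_diff)

text \<open>Flipping a coordinate of \<open>S\<close> outside \<open>A\<close> negates the Walsh
  function and fixes \<open>\<psi>\<close>.\<close>

lemma walsh_coeff_eq_0:
  assumes "S \<subseteq> {..<n}" "\<not> S \<subseteq> A"
    and dep: "\<And>x i. i \<notin> A \<Longrightarrow> \<psi> (x(i := \<not> x i)) = \<psi> x"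
  shows "walsh_coeff n \<psi> S = 0"
proof -
  obtain i where i: "i \<in> S" "i \<notin> A" using assms by blast
  have "finite S"
    using assms(1) finite_subset by blast
  then show ?thesis
    using i assms unfolding walsh_coeff_def
    by (intro cube_mean_flip_eq_0[of i]) (auto simp: walsh_flip)
qed

text \<open>Subtracting \<open>\<psi>\<close> leaves the coefficients at sets not contained in
  \<open>A\<close> unchanged, so their weight is part of the Parseval sum of the difference. The
  intended \<open>\<psi>\<close> is \<open>f(x \<and> y)\<close> as a function of \<open>y\<close>,
  with \<open>A\<close> the support of \<open>x\<close>.\<close>

lemma walsh_weight_outside_le:
  assumes "\<And>x i. i \<notin> A \<Longrightarrow> \<psi> (x(i := \<not> x i)) = \<psi> x"
  shows "(\<Sum>S | S \<subseteq> {..<n} \<and> \<not> S \<subseteq> A. (walsh_coeff n \<phi> S)\<^sup>2)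
    \<le> cube_mean n (\<lambda>x. (\<phi> x - \<psi> x)\<^sup>2)"
proof -
  have "(\<Sum>S | S \<subseteq> {..<n} \<and> \<not> S \<subseteq> A. (walsh_coeff n \<phi> S)\<^sup>2)
      = (\<Sum>S | S \<subseteq> {..<n} \<and> \<not> S \<subseteq> A. (walsh_coeff n (\<lambda>x. \<phi> x - \<psi> x) S)\<^sup>2)"
  proof (rule sum.cong)
    fix S assume "S \<in> {S. S \<subseteq> {..<n} \<and> \<not> S \<subseteq> A}"
    then have "walsh_coeff n \<psi> S = 0"
      using walsh_coeff_eq_0 assms by blast
    then show "(walsh_coeff n \<phi> S)\<^sup>2 = (walsh_coeff n (\<lambda>x. \<phi> x - \<psi> x) S)\<^sup>2"
      by (simp add: walsh_coeff_diff)
  qed simp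
  also have "\<dots> \<le> (\<Sum>S\<in>Pow {..<n}. (walsh_coeff n (\<lambda>x. \<phi> x - \<psi> x) S)\<^sup>2)"
    by (rule sum_mono2) auto
  finally show ?thesis by (simp only: parseval)
qed

text \<open>For \<open>I \<subseteq> {..<n}\<close> this is the orthogonal projection onto the
  functions of the coordinates in \<open>I\<close>, that is, the conditional expectation given these
  coordinates.\<close>

definition walsh_proj :: "nat \<Rightarrow> nat set \<Rightarrow> ((nat \<Rightarrow> bool) \<Rightarrow> real) \<Rightarrow> (nat \<Rightarrow> bool) \<Rightarrow> real" where
  "walsh_proj n I \<phi> x = (\<Sum>S\<in>Pow I. walsh_coeff n \<phi> S * walsh S x)"

lemma walsh_coeff_proj:
  assumes "I \<subseteq> {..<n}" "S \<subseteq> {..<n}"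
  shows "walsh_coeff n (walsh_proj n I \<phi>) S = (if S \<subseteq> I then walsh_coeff n \<phi> S else 0)"
proof -
  have fin: "finite (Pow I)"
    using assms(1) finite_subset by blast
  have "walsh_coeff n (walsh_proj n I \<phi>) S
      = (\<Sum>T\<in>Pow I. walsh_coeff n \<phi> T * cube_mean n (\<lambda>x. walsh T x * walsh S x))"
    by (simp add: walsh_coeff_def[of n "walsh_proj n I \<phi>"] walsh_proj_def sum_distrib_right
        cube_mean_sum mult.assoc cube_mean_mult_left)
  also have "\<dots> = (\<Sum>T\<in>Pow I. if T = S then walsh_coeff n \<phi> T else 0)"
    using assms by (intro sum.cong) (auto simp: walsh_orthonormal)
  also have "\<dots> = (if S \<subseteq> I then walsh_coeff n \<phi> S else 0)"
    using fin by simp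
  finally show ?thesis .
qed

lemma cube_mean_diff_walsh_proj:
  assumes "I \<subseteq> {..<n}"
  shows "cube_mean n (\<lambda>x. (\<phi> x - walsh_proj n I \<phi> x)\<^sup>2)
    = (\<Sum>S | S \<subseteq> {..<n} \<and> \<not> S \<subseteq> I. (walsh_coeff n \<phi> S)\<^sup>2)"
  unfolding parseval[symmetric]
  by (rule sum.mono_neutral_cong_right)
     (auto simp: walsh_coeff_diff walsh_coeff_proj[OF assms])

text \<open>Each factor of a Walsh function over a subset of \<open>I\<close> is -1 here, so the
  projection takes a single value on the whole subcube.\<close>

lemma walsh_proj_all_True:
  assumes "\<forall>i\<in>I. x i"
  shows "walsh_proj n I \<phi> x = (\<Sum>S\<in>Pow I. walsh_coeff n \<phi> S * (- 1) ^ card S)"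
  unfolding walsh_proj_def
proof (rule sum.cong)
  fix S assume "S \<in> Pow I"
  with assms have "walsh S x = (\<Prod>i\<in>S. - 1)"
    unfolding walsh_def by (intro prod.cong) auto
  then show "walsh_coeff n \<phi> S * walsh S x = walsh_coeff n \<phi> S * (- 1) ^ card S"
    by simp
qed simp

section \<open>Subcubes, and probabilities as averages\<close>

lemma cube_mean_all_True:
  assumes "J \<subseteq> {..<n}"
  shows "cube_mean n (\<lambda>x. of_bool (\<forall>i\<in>J. x i)) = (1 / 2) ^ card J"
proof -
  have "{x \<in> cube n. \<forall>i\<in>J. x i} = PiE {..<n} (\<lambda>i. if i \<in> J then {True} else UNIV)"
    using assms unfolding cube_def by (auto simp: PiE_iff extensional_def split: if_splits)
  moreover have "(\<Prod>i<n. card (if i \<in> J then {True} else UNIV)) = 2 ^ card ({..<n} - J)"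
  proof -
    have "(\<Prod>i<n. card (if i \<in> J then {True} else UNIV)) = (\<Prod>i<n. if i \<in> J then 1 else 2)"
      by (intro prod.cong) auto
    then show ?thesis by (simp add: prod.If_cases Diff_eq)
  qed
  ultimately have "card {x \<in> cube n. \<forall>i\<in>J. x i} = 2 ^ (n - card J)"
    using assms finite_subset[OF assms] by (simp add: card_PiE card_Diff_subset)
  then have "real (card {x \<in> cube n. \<forall>i\<in>J. x i}) = 2 ^ (n - card J)"
    by simp
  moreover have "card J \<le> n"
    using card_mono[OF _ assms] by simp
  ultimately show ?thesis
    by (simp add: cube_mean_def finite_cube Int_def power_diff field_simps)
qed

lemma prob_unif_cube: "measure_pmf.prob (unif_cube n) {x. P x} = cube_mean n (\<lambda>x. of_bool (P x))"
  by (simp add: unif_cube_def measure_pmf_of_set finite_cube cube_nonempty cube_mean_def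
      card_cube sum_of_bool_eq Int_def)

text \<open>The product of two uniform distributions is uniform on
  \<open>cube n \<times> cube n\<close>. The iterated form allows Fourier analysis in
  \<open>y\<close> with \<open>x\<close> held fixed.\<close>

lemma prob_unif_cube_pair:
  "measure_pmf.prob (pair_pmf (unif_cube n) (unif_cube n)) {(x, y). P x y}
    = cube_mean n (\<lambda>x. cube_mean n (\<lambda>y. of_bool (P x y)))"
proof -
  have "cube_mean n (\<lambda>x. cube_mean n (\<lambda>y. of_bool (P x y)))
      = (\<Sum>z\<in>cube n \<times> cube n. of_bool (P (fst z) (snd z))) / (2 ^ n * 2 ^ n)"
    by (simp add: cube_mean_def sum_divide_distrib[symmetric] sum.cartesian_product case_prod_beta)
  moreover have "pair_pmf (unif_cube n) (unif_cube n) = pmf_of_set (cube n \<times> cube n)"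
    by (intro pmf_eqI) (auto simp: unif_cube_def pmf_pair finite_cube cube_nonempty
        card_cartesian_product indicator_def)
  moreover have "(cube n \<times> cube n) \<inter> {(x, y). P x y} = {z \<in> cube n \<times> cube n. P (fst z) (snd z)}"
    by auto
  ultimately show ?thesis
    by (simp add: measure_pmf_of_set finite_cube cube_nonempty card_cube sum_of_bool_eq Int_def
        card_cartesian_product finite_cartesian_product)
qed

section \<open>From the AND test to a bound on Fourier weight\<close>

lemma cube_and_flip:
  "i \<notin> {i. i < n \<and> x i} \<Longrightarrow> cube_and n x (y(i := \<not> y i)) = cube_and n x y"
  by (auto simp: cube_and_def restrict_def)

text \<open>This is the part of the mass of \<open>f\<close> at points whose support does not
  contain \<open>S\<close>. It is not conditioned on \<open>f x\<close>, so thresholds for it carry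
  the mean of \<open>f\<close> as a factor.\<close>

definition zero_mass :: "nat \<Rightarrow> ((nat \<Rightarrow> bool) \<Rightarrow> bool) \<Rightarrow> nat set \<Rightarrow> real" where
  "zero_mass n f S = cube_mean n (\<lambda>x. of_bool (f x \<and> (\<exists>i\<in>S. \<not> x i)))"

lemma zero_mass_mono: "S \<subseteq> T \<Longrightarrow> zero_mass n f S \<le> zero_mass n f T"
  unfolding zero_mass_def by (rule cube_mean_mono) auto

text \<open>Union bound over the coordinates in \<open>S\<close>.\<close>

lemma zero_mass_le_sum:
  assumes "finite S"
  shows "zero_mass n f S \<le> (\<Sum>i\<in>S. zero_mass n f {i})"
proof -
  have "of_bool (f x \<and> (\<exists>i\<in>S. \<not> x i)) \<le> (\<Sum>i\<in>S. of_bool (f x \<and> \<not> x i) :: real)" for x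
  proof (cases "f x \<and> (\<exists>i\<in>S. \<not> x i)")
    case True
    then obtain i where "i \<in> S" "f x \<and> \<not> x i" by blast
    then show ?thesis
      using member_le_sum[of i S "\<lambda>i. of_bool (f x \<and> \<not> x i) :: real"] assms by simp
  qed (simp add: sum_nonneg)
  then show ?thesis
    by (simp add: zero_mass_def cube_mean_mono flip: cube_mean_sum)
qed

text \<open>Exchange the sum over \<open>S\<close> with the average over \<open>x\<close>. For fixed
  \<open>x\<close> with \<open>f x\<close>, the inner sum is the Fourier weight on sets not inside
  the support of \<open>x\<close>, which \<open>walsh_weight_outside_le\<close> bounds by the
  failure rate of the test at \<open>x\<close>.\<close>

lemma walsh_weight_zero_mass_le:
  fixes f :: "(nat \<Rightarrow> bool) \<Rightarrow> bool"
  assumes "measure_pmf.prob (pair_pmf (unif_cube n) (unif_cube n))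
    {(x, y). f (cube_and n x y) = (f x \<and> f y)} \<ge> 1 - \<epsilon>"
  shows "(\<Sum>S\<in>Pow {..<n}. (walsh_coeff n (\<lambda>x. of_bool (f x)) S)\<^sup>2 * zero_mass n f S) \<le> \<epsilon>"
proof -
  let ?\<phi> = "\<lambda>x. of_bool (f x) :: real"
  let ?W = "\<lambda>S. (walsh_coeff n ?\<phi> S)\<^sup>2"
  let ?err = "\<lambda>x y. 1 - of_bool (f (cube_and n x y) = (f x \<and> f y)) :: real"
  have "(\<Sum>S\<in>Pow {..<n}. ?W S * zero_mass n f S)
      = cube_mean n (\<lambda>x. \<Sum>S\<in>Pow {..<n}. ?W S * of_bool (f x \<and> (\<exists>i\<in>S. \<not> x i)))"
    unfolding zero_mass_def cube_mean_sum cube_mean_mult_left ..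
  also have "\<dots> \<le> cube_mean n (\<lambda>x. cube_mean n (?err x))"
  proof (rule cube_mean_mono)
    fix x :: "nat \<Rightarrow> bool"
    show "(\<Sum>S\<in>Pow {..<n}. ?W S * of_bool (f x \<and> (\<exists>i\<in>S. \<not> x i))) \<le> cube_mean n (?err x)"
    proof (cases "f x")
      case True
      let ?A = "{i. i < n \<and> x i}"
      have "(\<Sum>S\<in>Pow {..<n}. ?W S * of_bool (f x \<and> (\<exists>i\<in>S. \<not> x i)))
          = (\<Sum>S | S \<subseteq> {..<n} \<and> \<not> S \<subseteq> ?A. ?W S)"
        using True by (intro sum.mono_neutral_cong_right) auto
      also have "\<dots> \<le> cube_mean n (\<lambda>y. (?\<phi> y - ?\<phi> (cube_and n x y))\<^sup>2)"
        by (rule walsh_weight_outside_le) (metis cube_and_flip)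
      \<comment> \<open>Since \<open>f x\<close> holds, the test fails exactly when
        \<open>f y\<close> and \<open>f(x \<and> y)\<close> differ, and the squared difference is
        the indicator of this event.\<close>
      also have "\<dots> \<le> cube_mean n (?err x)"
        using True by (intro cube_mean_mono) (auto simp: of_bool_def)
      finally show ?thesis .
    qed (auto intro: cube_mean_nonneg)
  qed
  also have "\<dots> \<le> \<epsilon>"
    using assms unfolding prob_unif_cube_pair cube_mean_diff cube_mean_const by simp
  finally show ?thesis .
qed

section \<open>Finding the coordinates of the AND and rounding\<close>

text \<open>Quantitative form with an explicit error, independent of \<open>n\<close>. When the mean
  of \<open>f\<close> exceeds \<open>d\<close>, \<open>K\<close> bounds the number of coordinates of
  the AND.\<close>

lemma and_test_structure:
  fixes f :: "(nat \<Rightarrow> bool) \<Rightarrow> bool"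
  assumes d: "0 < d" "d \<le> 1" and K: "(1 / 2) ^ K < d / 2"
    and test: "measure_pmf.prob (pair_pmf (unif_cube n) (unif_cube n))
      {(x, y). f (cube_and n x y) = (f x \<and> f y)} \<ge> 1 - d ^ 3 / (16 * real K)"
  shows "\<exists>h. (const_fun_on_cube n h \<or> and_fun_on_cube n h) \<and>
    measure_pmf.prob (unif_cube n) {x. f x \<noteq> h x} \<le> d"
proof (cases "cube_mean n (\<lambda>x. of_bool (f x)) \<le> d")
  case True
  then show ?thesis
    by (intro exI[of _ "\<lambda>_. False"]) (auto simp: const_fun_on_cube_def prob_unif_cube)
next
  case False
  let ?\<phi> = "\<lambda>x. of_bool (f x) :: real"
  let ?W = "\<lambda>S. (walsh_coeff n ?\<phi> S)\<^sup>2"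
  define l where "l = cube_mean n ?\<phi>"
  have l: "d < l" "l \<le> 1"
    using False cube_mean_mono[of n ?\<phi> "\<lambda>_. 1"] by (auto simp: l_def cube_mean_const)
  have "K \<noteq> 0" using K d by (intro notI) simp
  \<comment> \<open>\<open>\<eta>\<close> is the fraction of the mass \<open>l\<close> that a
    coordinate of \<open>I\<close> may lose; at most \<open>K\<close> coordinates then lose at most
    \<open>d * l / 2\<close> in total.\<close>
  define \<eta> where "\<eta> = d / (2 * K)"
  have \<eta>: "0 < \<eta>" "K * \<eta> = d / 2" "d ^ 3 / (16 * real K) = d\<^sup>2 * \<eta> / 8"
    using d \<open>K \<noteq> 0\<close> by (simp_all add: \<eta>_def field_simps power2_eq_square power3_eq_cube)
  define I where "I = {i. i < n \<and> zero_mass n f {i} \<le> \<eta> * l}"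
  have I: "I \<subseteq> {..<n}" "finite I" by (auto simp: I_def)
  have zero_mass_le: "zero_mass n f J \<le> card J * (\<eta> * l)" if "J \<subseteq> I" for J
  proof -
    have "finite J" using that I finite_subset by blast
    then have "zero_mass n f J \<le> (\<Sum>i\<in>J. zero_mass n f {i})"
      by (rule zero_mass_le_sum)
    also have "\<dots> \<le> (\<Sum>i\<in>J. \<eta> * l)"
      using that by (intro sum_mono) (auto simp: I_def)
    finally show ?thesis by simp
  qed
  \<comment> \<open>If \<open>I\<close> had \<open>K\<close> coordinates, the mass of
    \<open>f\<close> would be at most that of a subcube of measure below \<open>d / 2\<close> plus a
    loss of at most \<open>d * l / 2\<close>. As \<open>d < l\<close> and \<open>d \<le> 1\<close>,
    the total would be below \<open>l\<close>.\<close>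
  have card_I: "card I < K"
  proof (rule ccontr)
    assume "\<not> card I < K"
    then obtain J where J: "J \<subseteq> I" "card J = K"
      by (meson obtain_subset_with_card_n not_less)
    have "l \<le> cube_mean n (\<lambda>x. of_bool (\<forall>i\<in>J. x i)) + zero_mass n f J"
      unfolding l_def zero_mass_def cube_mean_add[symmetric] by (rule cube_mean_mono) auto
    also have "\<dots> \<le> (1 / 2) ^ K + K * (\<eta> * l)"
      using J I zero_mass_le[OF J(1)] by (subst cube_mean_all_True) auto
    also have "\<dots> < d / 2 + d / 2 * l"
      using K unfolding \<eta>(2)[symmetric] mult.assoc by simp
    also have "\<dots> \<le> l / 2 + l / 2"
      using l d mult_left_le_one_le[of l d] by (intro add_mono) auto
    finally show False by simp
  qed
  define Q where "Q x \<longleftrightarrow> (\<forall>i\<in>I. x i)" for x :: "nat \<Rightarrow> bool"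
  have not_Q: "cube_mean n (\<lambda>x. of_bool (f x \<and> \<not> Q x)) \<le> d / 2"
  proof -
    have "cube_mean n (\<lambda>x. of_bool (f x \<and> \<not> Q x)) = zero_mass n f I"
      by (simp add: zero_mass_def Q_def)
    also have "\<dots> \<le> card I * (\<eta> * l)" by (rule zero_mass_le) simp
    also have "\<dots> \<le> K * (\<eta> * 1)"
      using card_I \<eta> l d by (intro mult_mono) auto
    finally show ?thesis using \<eta> by simp
  qed
  define c where "c = (\<Sum>S\<in>Pow I. walsh_coeff n ?\<phi> S * (- 1) ^ card S)"
  \<comment> \<open>A Markov-type argument: a set not inside \<open>I\<close> contains a coordinate
    whose zero mass exceeds \<open>\<eta> * l\<close>, so little weight can lie on such
    sets.\<close>
  have "(\<Sum>S | S \<subseteq> {..<n} \<and> \<not> S \<subseteq> I. ?W S) * (\<eta> * l)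
      \<le> (\<Sum>S | S \<subseteq> {..<n} \<and> \<not> S \<subseteq> I. ?W S * zero_mass n f S)"
    unfolding sum_distrib_right
  proof (rule sum_mono)
    fix S assume "S \<in> {S. S \<subseteq> {..<n} \<and> \<not> S \<subseteq> I}"
    then obtain i where "i \<in> S" "i < n" "i \<notin> I"
      by blast
    then have "i \<in> S" "\<eta> * l < zero_mass n f {i}"
      by (simp_all add: I_def not_le)
    then have "\<eta> * l \<le> zero_mass n f S"
      using zero_mass_mono[of "{i}" S n f] by simp
    then show "?W S * (\<eta> * l) \<le> ?W S * zero_mass n f S"
      by (simp add: mult_left_mono)
  qed
  also have "\<dots> \<le> (\<Sum>S\<in>Pow {..<n}. ?W S * zero_mass n f S)"
    by (rule sum_mono2) (auto simp: zero_mass_def intro!: mult_nonneg_nonneg cube_mean_nonneg)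
  also have "\<dots> \<le> d\<^sup>2 * \<eta> / 8"
    using walsh_weight_zero_mass_le[OF test] \<eta> by simp
  \<comment> \<open>Replacing one factor \<open>d\<close> by the larger \<open>l\<close> lets
    \<open>\<eta> * l\<close> cancel.\<close>
  also have "\<dots> \<le> d / 8 * (\<eta> * l)"
    using l d \<eta> by (simp add: power2_eq_square)
  finally have "(\<Sum>S | S \<subseteq> {..<n} \<and> \<not> S \<subseteq> I. ?W S) \<le> d / 8"
    using \<eta> l d by (simp only: mult_le_cancel_right) (simp add: zero_less_mult_iff)
  then have junta: "cube_mean n (\<lambda>x. (?\<phi> x - walsh_proj n I ?\<phi> x)\<^sup>2) \<le> d / 8"
    by (simp only: cube_mean_diff_walsh_proj[OF I(1)])
  have on_Q: "walsh_proj n I ?\<phi> x = c" if "Q x" for x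
    using that unfolding Q_def c_def by (rule walsh_proj_all_True)
  \<comment> \<open>Where all coordinates in \<open>I\<close> are 1, the projection is the constant
    \<open>c\<close>. A deviation of at least 1/2 costs a squared error of at least 1/4, so such
    points have measure at most \<open>4 * (d / 8)\<close>.\<close>
  have round: "cube_mean n (\<lambda>x. of_bool (P x)) \<le> d / 2"
    if "\<And>x. P x \<Longrightarrow> Q x \<and> 1 / 2 \<le> \<bar>?\<phi> x - c\<bar>" for P
  proof -
    have "cube_mean n (\<lambda>x. of_bool (P x)) \<le> cube_mean n (\<lambda>x. 4 * (?\<phi> x - walsh_proj n I ?\<phi> x)\<^sup>2)"
    proof (rule cube_mean_mono)
      fix x
      show "of_bool (P x) \<le> 4 * (?\<phi> x - walsh_proj n I ?\<phi> x)\<^sup>2"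
      proof (cases "P x")
        case True
        then have "(1 / 2)\<^sup>2 \<le> (?\<phi> x - walsh_proj n I ?\<phi> x)\<^sup>2"
          using that[OF True] on_Q by (simp only: abs_le_square_iff[symmetric]) simp
        then show ?thesis using True by (simp add: power2_eq_square)
      qed simp
    qed
    then show ?thesis using junta by (simp add: cube_mean_mult_left)
  qed
  \<comment> \<open>Otherwise the points of \<open>Q\<close> with \<open>f = 1\<close> all deviate
    by at least 1/2, and \<open>f\<close> has mass at most \<open>d / 2\<close> on \<open>Q\<close>
    and at most \<open>d / 2\<close> off it, against \<open>d < l\<close>.\<close>
  have "1 / 2 \<le> c"
  proof (rule ccontr)
    assume "\<not> 1 / 2 \<le> c"
    then have "cube_mean n (\<lambda>x. of_bool (f x \<and> Q x)) \<le> d / 2"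
      by (intro round) auto
    moreover have "l \<le> cube_mean n (\<lambda>x. of_bool (f x \<and> Q x)) + cube_mean n (\<lambda>x. of_bool (f x \<and> \<not> Q x))"
      unfolding l_def cube_mean_add[symmetric] by (rule cube_mean_mono) auto
    ultimately show False using not_Q l by simp
  qed
  \<comment> \<open>Now the points of \<open>Q\<close> with \<open>f = 0\<close> are the ones that
    deviate by at least 1/2 from \<open>c\<close>.\<close>
  then have "cube_mean n (\<lambda>x. of_bool (\<not> f x \<and> Q x)) \<le> d / 2"
    by (intro round) auto
  moreover have "cube_mean n (\<lambda>x. of_bool (f x \<noteq> Q x))
      \<le> cube_mean n (\<lambda>x. of_bool (f x \<and> \<not> Q x)) + cube_mean n (\<lambda>x. of_bool (\<not> f x \<and> Q x))"
    unfolding cube_mean_add[symmetric] by (rule cube_mean_mono) auto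
  ultimately have "measure_pmf.prob (unif_cube n) {x. f x \<noteq> Q x} \<le> d"
    using not_Q unfolding prob_unif_cube by simp
  moreover have "and_fun_on_cube n Q"
    unfolding and_fun_on_cube_def Q_def using I by blast
  ultimately show ?thesis by blast
qed

theorem theorem1p1:
  fixes \<delta> :: real
  assumes "\<delta> > 0"
  shows "\<exists>\<epsilon>::real. \<epsilon> > 0 \<and>
    (\<forall>(n::nat) (f :: (nat \<Rightarrow> bool) \<Rightarrow> bool).
      measure_pmf.prob (pair_pmf (unif_cube n) (unif_cube n))
        {(x, y). f (cube_and n x y) = (f x \<and> f y)} \<ge> 1 - \<epsilon> \<longrightarrow>
      (\<exists>h :: (nat \<Rightarrow> bool) \<Rightarrow> bool.
        (const_fun_on_cube n h \<or> and_fun_on_cube n h) \<and>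
        measure_pmf.prob (unif_cube n) {x. f x \<noteq> h x} \<le> \<delta>))"
proof -
  \<comment> \<open>The truncation provides \<open>d \<le> 1\<close>, which
    \<open>and_test_structure\<close> assumes; closeness within \<open>d\<close> implies closeness
    within \<open>\<delta>\<close>.\<close>
  define d where "d = min 1 \<delta>"
  have d: "0 < d" "d \<le> 1" "d \<le> \<delta>" using assms by (auto simp: d_def)
  obtain K where K: "(1 / 2 :: real) ^ K < d / 2"
    using real_arch_pow_inv[of "d / 2" "1 / 2"] d by auto
  then have "K \<noteq> 0" using d by (intro notI) simp
  show ?thesis
  proof (intro exI[of _ "d ^ 3 / (16 * real K)"] conjI allI impI)
    show "0 < d ^ 3 / (16 * real K)" using d \<open>K \<noteq> 0\<close> by simp
  next
    fix n and f :: "(nat \<Rightarrow> bool) \<Rightarrow> bool"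
    assume "1 - d ^ 3 / (16 * real K) \<le> measure_pmf.prob (pair_pmf (unif_cube n) (unif_cube n))
      {(x, y). f (cube_and n x y) = (f x \<and> f y)}"
    from and_test_structure[OF d(1,2) K this] d(3)
    show "\<exists>h. (const_fun_on_cube n h \<or> and_fun_on_cube n h) \<and>
      measure_pmf.prob (unif_cube n) {x. f x \<noteq> h x} \<le> \<delta>"
      by (meson order_trans)
  qed
qed

end
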